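(* Let $\mathbf{s}$ be a standard episturmian word over a finite alphabet $\mathcal{A}$ whose directive word is $\Delta(\mathbf{s})=x_1x_2x_3\cdots=y_1^{d_1}y_2^{d_2}y_3^{d_3}\cdots$, where $x_i,y_i\in\mathcal{A}$, $d_i\ge 1$ are integers and $y_i\neq y_{i+1}$ for all $i\ge 1$. For $m\ge 1$ put $g(m)=d_1+\cdots+d_{m-1}+1$. Then the Ziv-Lempel factorization $z(\mathbf{s})=(z_1,z_2,\ldots)$ of $\mathbf{s}$ is given by $z_1=x_1$ and $$z_k=y_{k-1}^{-1}\big(\overline{h_{g(k-1)-1}}\big)^{d_{k-1}}y_k\qquad\text{for all }k\ge 2.$$
   Context: Words: for words $u,w$ with $w=uv$ write $u^{-1}w=v$; $\overline{w}$ denotes the reversal of $w$ (for $w=w_1\cdots w_n$, $\overline w=w_n\cdots w_1$); $w$ is a palindrome if $w=\overline w$. An infinite word is episturmian if its set of factors is closed under reversal and for each length $\ell$ it has at most one right special factor of length $\ell$; it is standard if all its left special factors are prefixes of it. For a word $w$, $w^{(+)}$ is the shortest palindrome having $w$ as a prefix. If $u_1=\varepsilon,u_2,u_3,\ldots$ is the sequence of palindromic prefixes of a standard episturmian word $\mathbf{s}$ (in increasing length), there is an infinite word $\Delta(\mathbf{s})=x_1x_2\cdots$ (its directive word) with $u_{n+1}=(u_nx_n)^{(+)}$ for all $n\ge1$; $\mathbf s$ is the infinite word having every $u_n$ as a prefix. For $a\in\mathcal A$ let $\psi_a$ be the morphism with $\psi_a(a)=a$ and $\psi_a(x)=ax$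 for $x\neq a$; let $\mu_0=\mathrm{Id}$, $\mu_n=\psi_{x_1}\cdots\psi_{x_n}$, and $h_n=\mu_n(x_{n+1})$ for $n\ge 0$. (Known: $u_{n+1}=h_{n-1}u_n$ for $n\ge1$.) Ziv-Lempel factorization: the z-factorization of an infinite word $\mathbf{w}$ is $z(\mathbf{w})=(z_1,z_2,\ldots)$ with $\mathbf w=z_1z_2\cdots$, where each $z_m$ is the shortest prefix of $z_mz_{m+1}\cdots$ which occurs only once (as a factor) in the word $z_1\cdots z_m$. *)

theory Defs
  imports "HOL-Library.Stream" "HOL-Library.Sublist"
begin

text \<open>
  Finite words are lists and infinite words are streams. Sequences that are numbered from 1 in
  the literature are functions on \<^typ>\<open>nat\<close> whose value at 0 is never used; such a
  sequence \<open>f\<close> of letters spells the infinite word \<open>smap f (fromN 1)\<close>, and such a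
  sequence of nonempty words has the infinite concatenation \<open>flat (smap f (fromN 1))\<close>.
\<close>

definition sprefix :: "'a list \<Rightarrow> 'a stream \<Rightarrow> bool" where
  "sprefix w s \<longleftrightarrow> (\<exists>t. s = w @- t)"

definition factors :: "'a stream \<Rightarrow> 'a list set" where
  "factors s = {w. \<exists>v t. s = v @- w @- t}"

definition right_special :: "'a stream \<Rightarrow> 'a list \<Rightarrow> bool" where
  "right_special s w \<longleftrightarrow> (\<exists>a b. a \<noteq> b \<and> w @ [a] \<in> factors s \<and> w @ [b] \<in> factors s)"

definition left_special :: "'a stream \<Rightarrow> 'a list \<Rightarrow> bool" where
  "left_special s w \<longleftrightarrow> (\<exists>a b. a \<noteq> b \<and> a # w \<in> factors s \<and> b # w \<in> factors s)"

definition episturmian :: "'a stream \<Rightarrow> bool" where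
  "episturmian s \<longleftrightarrow>
     (\<forall>w \<in> factors s. rev w \<in> factors s) \<and>
     (\<forall>v w. right_special s v \<and> right_special s w \<and> length v = length w \<longrightarrow> v = w)"

definition standard_episturmian :: "'a stream \<Rightarrow> bool" where
  "standard_episturmian s \<longleftrightarrow> episturmian s \<and> (\<forall>w. left_special s w \<longrightarrow> sprefix w s)"

definition palindrome :: "'a list \<Rightarrow> bool" where
  "palindrome w \<longleftrightarrow> w = rev w"

definition pal_closure :: "'a list \<Rightarrow> 'a list" where
  "pal_closure w = (ARG_MIN length p. palindrome p \<and> prefix w p)"

text \<open>\<open>directive_word s x\<close> means \<open>\<Delta>(s) = x\<^sub>1 x\<^sub>2 x\<^sub>3 \<dots>\<close>. The first two conjuncts say
  that \<open>u\<^sub>1, u\<^sub>2, \<dots>\<close> lists all palindromic prefixes of \<open>s\<close> by increasing length; in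
  particular \<open>u\<^sub>1\<close> is the empty word.\<close>

definition directive_word :: "'a stream \<Rightarrow> (nat \<Rightarrow> 'a) \<Rightarrow> bool" where
  "directive_word s x \<longleftrightarrow>
     (\<exists>u. strict_mono_on {1..} (\<lambda>n. length (u n)) \<and>
          u ` {1..} = {p. palindrome p \<and> sprefix p s} \<and>
          (\<forall>n\<ge>1. u (n + 1) = pal_closure (u n @ [x n])))"

definition psi :: "'a \<Rightarrow> 'a list \<Rightarrow> 'a list" where
  "psi a w = concat (map (\<lambda>b. if b = a then [a] else [a, b]) w)"

fun mu :: "(nat \<Rightarrow> 'a) \<Rightarrow> nat \<Rightarrow> 'a list \<Rightarrow> 'a list" where
  "mu x 0 = id"
| "mu x (Suc n) = mu x n \<circ> psi (x (Suc n))"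

definition hword :: "(nat \<Rightarrow> 'a) \<Rightarrow> nat \<Rightarrow> 'a list" where
  "hword x n = mu x n [x (n + 1)]"

definition word_power :: "'a list \<Rightarrow> nat \<Rightarrow> 'a list" where
  "word_power w n = concat (replicate n w)"

text \<open>The word \<open>u\<^sup>-\<^sup>1 w\<close>; only meaningful if \<open>u\<close> is a prefix of \<open>w\<close>.\<close>

definition left_quotient :: "'a list \<Rightarrow> 'a list \<Rightarrow> 'a list" where
  "left_quotient u w = (THE v. w = u @ v)"

text \<open>Overlapping occurrences count as different: an occurrence is given by the part of the
  word that precedes it.\<close>

definition occurs_once :: "'a list \<Rightarrow> 'a list \<Rightarrow> bool" where
  "occurs_once p w \<longleftrightarrow> (\<exists>!v. \<exists>v'. w = v @ p @ v')"

text \<open>Each candidate \<open>p\<close> for \<open>z\<^sub>m\<close> is a nonempty prefix of the remaining word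
  \<open>z\<^sub>m z\<^sub>m\<^sub>+\<^sub>1 \<dots>\<close>, and its occurrences are counted in \<open>z\<^sub>1 \<dots> z\<^sub>m\<^sub>-\<^sub>1 p\<close>. The empty word has to be
  excluded because it occurs exactly once in the empty word.\<close>

definition z_factorization :: "'a stream \<Rightarrow> (nat \<Rightarrow> 'a list) \<Rightarrow> bool" where
  "z_factorization w z \<longleftrightarrow>
     (\<forall>m\<ge>1. z m \<noteq> []) \<and>
     w = flat (smap z (fromN 1)) \<and>
     (\<forall>m\<ge>1. is_arg_min length
        (\<lambda>p. p \<noteq> [] \<and> sprefix p (flat (smap z (fromN m))) \<and>
             occurs_once p (concat (map z [1..<m]) @ p)) (z m))"

end

theory Submission
  imports Defs
begin

text \<open>
  Let \<open>w\<^sub>k = x\<^sub>1 \<dots> x\<^sub>g\<^sub>(\<^sub>k\<^sub>)\<^sub>-\<^sub>1\<close>, let \<open>P\<^sub>k = u\<^sub>g\<^sub>(\<^sub>k\<^sub>)\<close> be its iterated palindromic closure, and put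
  \<open>h = h\<^sub>g\<^sub>(\<^sub>k\<^sub>)\<^sub>-\<^sub>1\<close>, \<open>d = d\<^sub>k\<close>. The claimed factors satisfy \<open>z\<^sub>1 \<dots> z\<^sub>k = P\<^sub>k y\<^sub>k\<close>, because appending
  \<open>y\<^sub>k\<^sup>d\<close> to \<open>w\<^sub>k\<close> turns \<open>P\<^sub>k\<close> into \<open>P\<^sub>k\<^sub>+\<^sub>1 = h\<^sup>d P\<^sub>k\<close>, which by reversal is \<open>P\<^sub>k (rev h)\<^sup>d\<close>. This word
  has the period \<open>length h \<le> length P\<^sub>k + 1\<close>, so every proper prefix of \<open>z\<^sub>k\<^sub>+\<^sub>1\<close> has occurred one
  period earlier. The word \<open>z\<^sub>k\<^sub>+\<^sub>1\<close> itself is new: writing \<open>h = r y\<^sub>k\<close>, it ends in \<open>rev r\<close> followed by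
  the letter \<open>c = y\<^sub>k\<^sub>+\<^sub>1 \<noteq> y\<^sub>k\<close>, and \<open>c r\<close> is not a factor of the palindrome \<open>P\<^sub>k\<^sub>+\<^sub>1\<close>, as one sees by
  removing the outermost morphism \<open>psi\<close> until \<open>r\<close> is empty and \<open>P\<^sub>k\<^sub>+\<^sub>1\<close> has become the word \<open>y\<^sub>k\<close>.
\<close>

section \<open>Decoding the morphism \<open>psi\<close>\<close>

lemma psi_Nil [simp]: "psi a [] = []"
  by (simp add: psi_def)

lemma psi_Cons [simp]: "psi a (b # w) = (if b = a then [a] else [a, b]) @ psi a w"
  by (simp add: psi_def)

lemma psi_append [simp]: "psi a (v @ w) = psi a v @ psi a w"
  by (simp add: psi_def)

lemma psi_eq_Nil [simp]: "psi a w = [] \<longleftrightarrow> w = []"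
  by (cases w) auto

text \<open>With the final \<open>a\<close>, each letter other than \<open>a\<close> has an
  \<open>a\<close> on both sides. This symmetry is why most lemmas on \<open>psi\<close> carry
  \<open>@ [a]\<close>.\<close>

lemma psi_rev: "psi a (rev w) @ [a] = rev (psi a w @ [a])"
  by (induction w) auto

lemma psi_snoc_hd: obtains u where "psi a w @ [a] = a # u"
proof -
  have "psi a w @ [a] = a # tl (psi a w @ [a])"
    by (cases w) auto
  then show thesis by (rule that)
qed

text \<open>The letter after the \<open>a\<close> that opens a block tells whether the block is
  \<open>[a]\<close> or \<open>[a, b]\<close>; the final \<open>a\<close> provides this letter for
  the last block too.\<close>

lemma psi_prefixD: "prefix (psi a v @ [a]) (psi a w @ [a]) \<Longrightarrow> prefix v w"
proof (induction v arbitrary: w)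
  case (Cons b v)
  show ?case
  proof (cases w)
    case Nil
    then show ?thesis
      using Cons.prems by (auto simp: prefix_def split: if_splits)
  next
    case w: (Cons c w')
    obtain t where t: "psi a v @ [a] = a # t" by (rule psi_snoc_hd)
    obtain u where u: "psi a w' @ [a] = a # u" by (rule psi_snoc_hd)
    have "prefix ((if b = a then [a] else [a, b]) @ a # t) ((if c = a then [a] else [a, c]) @ a # u)"
      using Cons.prems unfolding w psi_Cons append_assoc t u .
    then have "b = c \<and> prefix (a # t) (a # u)"
      by (auto split: if_splits)
    then show ?thesis
      using Cons.IH[of w'] unfolding w t u by simp
  qed
qed simp

lemma psi_inj: "psi a v @ [a] = psi a w @ [a] \<Longrightarrow> v = w"
  by (rule prefix_order.antisym; rule psi_prefixD[of a]) simp_all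

lemma palindrome_psi: "palindrome w \<Longrightarrow> palindrome (psi a w @ [a])"
  by (metis palindrome_def psi_rev)

lemma palindrome_psiD: "palindrome (psi a w @ [a]) \<Longrightarrow> palindrome w"
  unfolding palindrome_def psi_rev[symmetric] by (rule psi_inj)

text \<open>The added \<open>a\<close> completes a block \<open>[a, b]\<close> cut in its middle, or
  is a block of its own if the cut is at a block boundary; for empty \<open>e\<close> it is the
  final \<open>a\<close>.\<close>

lemma suffix_psi:
  "suffix e (psi a w @ [a]) \<Longrightarrow> \<exists>f. a # e = psi a f @ [a]"
proof (induction w)
  case Nil
  then have "e = [] \<or> e = [a]"
    by (auto simp: suffix_Cons)
  then have "a # e = psi a [] @ [a] \<or> a # e = psi a [a] @ [a]"
    by auto
  then show ?case by blast
next
  case (Cons b w)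
  from Cons.prems consider "suffix e (psi a w @ [a])" | "e = psi a (b # w) @ [a]"
    | "b \<noteq> a" "e = b # psi a w @ [a]"
    by (auto simp: suffix_Cons split: if_splits)
  then show ?case
  proof cases
    case 1
    then show ?thesis by (rule Cons.IH)
  next
    case 2
    then have "a # e = psi a (a # b # w) @ [a]" by simp
    then show ?thesis by blast
  next
    case 3
    then have "a # e = psi a (b # w) @ [a]" by simp
    then show ?thesis by blast
  qed
qed

section \<open>Palindromic closure and its commutation with \<open>psi\<close>\<close>

lemma pal_closure_props:
  shows palindrome_pal_closure: "palindrome (pal_closure w)"
    and prefix_pal_closure: "prefix w (pal_closure w)"
    and pal_closure_le: "palindrome p \<Longrightarrow> prefix w p \<Longrightarrow> length (pal_closure w) \<le> length p"
proof -
  have ex: "palindrome (w @ rev w) \<and> prefix w (w @ rev w)"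
    by (simp add: palindrome_def)
  show "palindrome (pal_closure w)" "prefix w (pal_closure w)"
    unfolding pal_closure_def
    using arg_min_natI[where P = "\<lambda>p. palindrome p \<and> prefix w p" and m = length, OF ex]
    by auto
  show "length (pal_closure w) \<le> length p" if "palindrome p" "prefix w p"
    unfolding pal_closure_def
    using that by (intro arg_min_nat_le) auto
qed

lemma length_pal_closure_snoc:
  assumes "palindrome P"
  shows "length (pal_closure (P @ [x])) \<le> 2 * length P + 1"
proof -
  have "palindrome (P @ [x] @ P)"
    using assms by (simp add: palindrome_def)
  from pal_closure_le[OF this, of "P @ [x]"] show ?thesis
    by simp
qed

lemma suffix_of_palindrome:
  assumes "palindrome P" "palindrome Q" "prefix (P @ [x]) Q"
  shows "suffix (x # P) Q"
  using assms by (simp add: suffix_to_prefix palindrome_def)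

lemma pal_closure_snoc:
  assumes "palindrome P"
  obtains e where "pal_closure (P @ [x]) = P @ x # e" "suffix (x # e) (x # P)"
proof -
  let ?Q = "pal_closure (P @ [x])"
  obtain e where e: "?Q = P @ x # e"
    using prefix_pal_closure[of "P @ [x]"] by (auto simp: prefix_def)
  have "suffix (x # P) ?Q"
    by (rule suffix_of_palindrome[OF assms palindrome_pal_closure prefix_pal_closure])
  moreover have "suffix (x # e) ?Q"
    by (simp add: e suffix_def)
  moreover have "length (x # e) \<le> length (x # P)"
    using length_pal_closure_snoc[OF assms, of x] by (simp add: e)
  ultimately have "suffix (x # e) (x # P)"
    by (metis suffix_length_suffix)
  with e that show thesis by blast
qed

text \<open>The closure on the left decodes to a palindrome \<open>P @ f\<close> that begins with
  \<open>P @ [x]\<close>, and the image of \<open>pal_closure (P @ [x])\<close> is a competitor for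
  it. Minimality on both sides forces equality.\<close>

lemma pal_closure_psi:
  assumes P: "palindrome P"
  shows "pal_closure (psi a P @ [a, x]) = psi a (pal_closure (P @ [x])) @ [a]"
proof -
  let ?V = "psi a P @ [a]"
  obtain \<alpha> where R: "pal_closure (P @ [x]) = P @ x # \<alpha>" "suffix (x # \<alpha>) (x # P)"
    by (rule pal_closure_snoc[OF P])
  obtain e where Q: "pal_closure (?V @ [x]) = ?V @ x # e" "suffix (x # e) (x # ?V)"
    by (rule pal_closure_snoc[OF palindrome_psi[OF P]])
  have "suffix (x # ?V) (psi a (x # P) @ [a])"
    by (auto simp: suffix_def)
  with Q(2) have "suffix (x # e) (psi a (x # P) @ [a])"
    by (rule suffix_order.trans)
  from suffix_psi[OF this] obtain f where f: "a # x # e = psi a f @ [a]"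
    by blast
  \<comment> \<open>If the first block of \<open>f\<close> is \<open>[a]\<close>, the next letter is
    \<open>a\<close> again, so \<open>x = a\<close>; otherwise the block is
    \<open>[a, x]\<close>.\<close>
  obtain u where u: "psi a (tl f) @ [a] = a # u"
    by (rule psi_snoc_hd)
  from f u obtain f' where f': "f = x # f'"
    by (cases f) (auto split: if_splits)
  have Q': "pal_closure (?V @ [x]) = psi a (P @ f) @ [a]"
    using Q(1) f by simp
  have pal: "palindrome (P @ f)"
    using palindrome_pal_closure[of "?V @ [x]"] unfolding Q' by (rule palindrome_psiD)
  have "length (P @ x # \<alpha>) \<le> length (P @ f)"
    unfolding R(1)[symmetric] by (rule pal_closure_le[OF pal]) (simp add: f')
  then have le: "length (x # \<alpha>) \<le> length f"
    by simp
  \<comment> \<open>An inequality of lengths alone does not pass through \<open>psi a\<close>. As a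
    suffix of \<open>f\<close>, however, \<open>x # \<alpha>\<close> differs from it by a word
    \<open>\<beta>\<close> that the second comparison shows to be empty.\<close>
  have "suffix (x # P) (P @ f)"
    by (rule suffix_of_palindrome[OF P pal]) (simp add: f')
  with R(2) have "suffix (x # \<alpha>) (P @ f)"
    by (rule suffix_order.trans)
  moreover have "suffix f (P @ f)"
    by (simp add: suffix_def)
  ultimately have "suffix (x # \<alpha>) f"
    using le by (metis suffix_length_suffix)
  then obtain \<beta> where \<beta>: "f = \<beta> @ x # \<alpha>"
    by (auto simp: suffix_def)
  have "palindrome (psi a (P @ x # \<alpha>) @ [a])"
    unfolding R(1)[symmetric] by (intro palindrome_psi palindrome_pal_closure)
  moreover have "prefix (?V @ [x]) (psi a (P @ x # \<alpha>) @ [a])"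
    by (cases \<alpha>) (auto simp: prefix_def)
  ultimately have "length (psi a (P @ f) @ [a]) \<le> length (psi a (P @ x # \<alpha>) @ [a])"
    unfolding Q'[symmetric] by (rule pal_closure_le)
  then have "f = x # \<alpha>"
    by (simp add: \<beta>)
  then show ?thesis
    using Q' R(1) by simp
qed

text \<open>Palindromic closure commutes with \<open>psi\<close> (\<open>pal_closure_psi\<close>), so this recursion from the left
  computes the iterated palindromic closure of \<open>w\<close>, see \<open>pal_snoc\<close>: the palindromic prefix
  \<open>u\<^sub>n\<^sub>+\<^sub>1\<close> is \<open>pal [x\<^sub>1, \<dots>, x\<^sub>n]\<close>.\<close>

fun pal :: "'a list \<Rightarrow> 'a list" where
  "pal [] = []"
| "pal (a # w) = psi a (pal w) @ [a]"

lemma palindrome_pal: "palindrome (pal w)"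
  by (induction w) (simp add: palindrome_def, simp add: palindrome_psi)

lemma pal_snoc: "pal (w @ [x]) = pal_closure (pal w @ [x])"
proof (induction w)
  case Nil
  have "palindrome ([] :: 'a list)"
    by (simp add: palindrome_def)
  then obtain e where "pal_closure ([] @ [x]) = [] @ x # e" "suffix (x # e) [x]"
    by (rule pal_closure_snoc)
  then show ?case
    by (auto simp: suffix_Cons)
next
  case (Cons a w)
  then show ?case
    by (simp add: pal_closure_psi[OF palindrome_pal])
qed

text \<open>For \<open>w = [x\<^sub>1, ..., x\<^sub>n]\<close> and
  \<open>x = x\<^sub>n\<^sub>+\<^sub>1\<close> this is the known recursion
  \<open>u\<^sub>n\<^sub>+\<^sub>2 = h\<^sub>n u\<^sub>n\<^sub>+\<^sub>1\<close>.\<close>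

lemma pal_snoc': "pal (w @ [x]) = foldr psi w [x] @ pal w"
  by (induction w) auto

lemma length_foldr_psi_le: "length (foldr psi w [x]) \<le> length (pal w) + 1"
  using length_pal_closure_snoc[OF palindrome_pal[of w], of x]
  unfolding pal_snoc[symmetric] pal_snoc' by simp

text \<open>\<open>psi\<close> keeps the last letter. The clause on \<open>last r\<close> serves
  \<open>not_sublist_pal\<close>, where an \<open>a\<close> is forced to follow a letter other than
  \<open>a\<close>.\<close>

lemma foldr_psi_snoc:
  obtains r where "foldr psi w [y] = r @ [y]" "r = [] \<or> last r \<noteq> y"
proof -
  have "\<exists>r. foldr psi w [y] = r @ [y] \<and> (r = [] \<or> last r \<noteq> y)"
  proof (induction w)
    case (Cons a w)
    then obtain r where r: "foldr psi w [y] = r @ [y]" "r = [] \<or> last r \<noteq> y"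
      by blast
    show ?case
    proof (cases "y = a")
      case True
      have "psi a r = [] \<or> last (psi a r) \<noteq> y"
        using r(2) True by (cases r rule: rev_cases) auto
      then show ?thesis
        using r(1) True by simp
    next
      case False
      then have "foldr psi (a # w) [y] = (psi a r @ [a]) @ [y]"
        using r(1) by simp
      then show ?thesis
        using False by (metis last_snoc)
    qed
  qed simp
  with that show thesis by blast
qed

section \<open>A word that does not occur in the palindromic prefix\<close>

text \<open>The pattern starts with \<open>a\<close>, so it cannot start at the second letter of a
  block \<open>[a, b]\<close>; at a block boundary \<open>psi_prefixD\<close> applies.\<close>

lemma psi_sublistD: "sublist (psi a v @ [a]) (psi a w @ [a]) \<Longrightarrow> sublist v w"
proof (induction w)
  case Nil
  then have "length (psi a v @ [a]) \<le> length [a]"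
    by (metis psi_Nil append_Nil sublist_length_le)
  then show ?case by simp
next
  case (Cons b w)
  have hd: "psi a v @ [a] = a # tl (psi a v @ [a])"
    by (cases v) auto
  from Cons.prems consider "prefix (psi a v @ [a]) (psi a (b # w) @ [a])"
    | "sublist (psi a v @ [a]) (psi a w @ [a])"
    | "b \<noteq> a" "prefix (psi a v @ [a]) (b # psi a w @ [a])"
    by (auto simp: sublist_Cons_right split: if_splits)
  then show ?case
  proof cases
    case 1
    then show ?thesis by (metis psi_prefixD prefix_imp_sublist)
  next
    case 2
    then show ?thesis using Cons.IH by (auto simp: sublist_Cons_right)
  next
    case 3
    then show ?thesis by (metis hd Cons_prefix_Cons)
  qed
qed

lemma psi_letter_before:
  assumes "psi a w @ [a] = p @ c # q" "c \<noteq> a"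
  shows "\<exists>p'. p = p' @ [a]"
  using assms
proof (induction w arbitrary: p)
  case Nil
  then show ?case by (cases p) auto
next
  case (Cons b w)
  then obtain p1 where p1: "p = a # p1"
    by (cases p) (auto split: if_splits)
  show ?case
  proof (cases "b = a")
    case True
    then have "psi a w @ [a] = p1 @ c # q"
      using Cons.prems p1 by simp
    then show ?thesis
      using Cons.IH Cons.prems(2) p1 by fastforce
  next
    case False
    then have eq: "b # psi a w @ [a] = p1 @ c # q"
      using Cons.prems p1 by simp
    note IH = Cons.IH[OF _ Cons.prems(2)]
    show ?thesis
    proof (cases p1)
      case Nil
      then show ?thesis using p1 by simp
    next
      case (Cons b' p2)
      then have "psi a w @ [a] = p2 @ c # q"
        using eq by simp
      then obtain p' where "p2 = p' @ [a]"
        using IH by blast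
      then show ?thesis
        using p1 Cons by simp
    qed
  qed
qed

lemma psi_letter_after:
  assumes "psi a w @ [a] = p @ c # q" "c \<noteq> a"
  shows "\<exists>q'. q = a # q'"
proof -
  have "rev (psi a w @ [a]) = rev q @ c # rev p"
    by (simp add: assms(1))
  then have "psi a (rev w) @ [a] = rev q @ c # rev p"
    by (simp only: psi_rev)
  from psi_letter_before[OF this assms(2)] show ?thesis
    by (auto simp: rev_swap)
qed

text \<open>With \<open>t\<close> playing the role of \<open>r\<close> for the shorter
  \<open>w\<close>, an occurrence of \<open>c # r\<close> extends by forced letters \<open>a\<close>
  to one of \<open>psi a (c # t) @ [a]\<close>, which decodes to \<open>c # t\<close>.\<close>

lemma not_sublist_pal:
  assumes "c \<noteq> y" "foldr psi w [y] = r @ [y]"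
  shows "\<not> sublist (c # r) (pal (w @ [y]))"
  using assms(2)
proof (induction w arbitrary: r)
  case Nil
  then show ?case using assms(1) by (auto simp: sublist_Cons_right)
next
  case (Cons a w)
  obtain t where t: "foldr psi w [y] = t @ [y]" "t = [] \<or> last t \<noteq> y"
    by (rule foldr_psi_snoc)
  let ?U = "pal (w @ [y])"
  show ?case
  proof
    assume "sublist (c # r) (pal ((a # w) @ [y]))"
    then obtain p q where pq: "psi a ?U @ [a] = p @ c # r @ q"
      by (auto simp: sublist_def)
    have "sublist (psi a (c # t) @ [a]) (psi a ?U @ [a])"
    proof (cases "y = a")
      case False
      then have r: "r = psi a t @ [a]"
        using Cons.prems t(1) by simp
      show ?thesis
      proof (cases "c = a")
        case True
        then have "psi a ?U @ [a] = p @ (psi a (c # t) @ [a]) @ q"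
          using pq r by simp
        then show ?thesis
          unfolding sublist_def by blast
      next
        case False
        then obtain p' where "p = p' @ [a]"
          using psi_letter_before[OF pq] by blast
        then have "psi a ?U @ [a] = p' @ (psi a (c # t) @ [a]) @ q"
          using False pq r by simp
        then show ?thesis
          unfolding sublist_def by blast
      qed
    next
      case True
      then have r: "r = psi a t"
        using Cons.prems t(1) by simp
      have ca: "c \<noteq> a" using True assms(1) by simp
      then obtain p' where p': "p = p' @ [a]"
        using psi_letter_before[OF pq] by blast
      \<comment> \<open>Here \<open>r\<close> lacks the final \<open>a\<close>; it is supplied by
        the letter that must follow \<open>b\<close>, the last letter of
        \<open>c # t\<close>.\<close>
      have "last (c # t) \<noteq> a"
        using t(2) True ca by auto
      then obtain v b where "c # t = v @ [b]" "b \<noteq> a"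
        by (cases "c # t" rule: rev_cases) auto
      then have eq: "psi a (c # t) = psi a v @ [a, b]"
        by (simp only: psi_append) simp
      have "psi a ?U @ [a] = p' @ psi a (c # t) @ q"
        using pq p' r ca by simp
      then have U: "psi a ?U @ [a] = (p' @ psi a v @ [a]) @ b # q"
        unfolding eq by simp
      then obtain q' where "q = a # q'"
        using psi_letter_after[OF U \<open>b \<noteq> a\<close>] by blast
      then have "psi a ?U @ [a] = p' @ (psi a (c # t) @ [a]) @ q'"
        using U eq by simp
      then show ?thesis
        unfolding sublist_def by blast
    qed
    then have "sublist (c # t) ?U"
      by (rule psi_sublistD)
    with Cons.IH[OF t(1)] show False ..
  qed
qed

section \<open>Blocks of equal letters in the directive word\<close>

lemma foldr_psi_replicate: "foldr psi (replicate n y) [y] = [y]"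
  by (induction n) auto

lemma word_power_Suc: "word_power w (Suc n) = w @ word_power w n"
  by (simp add: word_power_def)

lemma word_power_Suc': "word_power w (Suc n) = word_power w n @ w"
  by (induction n) (auto simp: word_power_def)

lemma rev_word_power: "rev (word_power w n) = word_power (rev w) n"
proof (induction n)
  case (Suc n)
  then show ?case
    by (subst word_power_Suc') (simp add: word_power_Suc)
qed (simp add: word_power_def)

text \<open>Since \<open>psi y\<close> fixes \<open>[y]\<close>, each of the \<open>n\<close>
  letters prepends the same word.\<close>

lemma pal_replicate: "pal (w @ replicate n y) = word_power (foldr psi w [y]) n @ pal w"
proof (induction n)
  case (Suc n)
  have "pal (w @ replicate (Suc n) y) = pal ((w @ replicate n y) @ [y])"
    by (simp add: replicate_append_same)
  also have "\<dots> = foldr psi w [y] @ pal (w @ replicate n y)"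
    by (simp only: pal_snoc' foldr_append foldr_psi_replicate)
  finally show ?case
    by (simp add: Suc.IH word_power_Suc)
qed (simp add: word_power_def)

lemma pal_replicate':
  "pal (w @ replicate n y) = pal w @ word_power (rev (foldr psi w [y])) n"
proof -
  have "pal (w @ replicate n y) = rev (word_power (foldr psi w [y]) n @ pal w)"
    using palindrome_pal[of "w @ replicate n y"] unfolding palindrome_def pal_replicate .
  then show ?thesis
    using palindrome_pal[of w] by (simp add: palindrome_def rev_word_power)
qed

section \<open>Infinite concatenations and uniqueness of the factorization\<close>

lemma flat_smap_fromN:
  assumes "\<And>i. i \<ge> m \<Longrightarrow> f i \<noteq> []" "m \<le> n"
  shows "flat (smap f (fromN m)) = concat (map f [m..<n]) @- flat (smap f (fromN n))"
  using assms(2)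
proof (induction n rule: dec_induct)
  case (step n)
  have "flat (smap f (fromN n)) = f n @- flat (smap f (fromN (Suc n)))"
    using assms(1)[OF step.hyps(1)] by (subst flat_unfold) auto
  then show ?case
    using step by simp
qed simp

lemma sprefix_shift [simp]: "sprefix u (u @- t)"
  by (auto simp: sprefix_def)

lemma sprefix_appendD: "sprefix (u @ v) s \<Longrightarrow> sprefix u s"
  by (auto simp: sprefix_def)

lemma sprefix_iff_stake: "sprefix u s \<longleftrightarrow> u = stake (length u) s"
proof
  assume "u = stake (length u) s"
  then have "s = u @- sdrop (length u) s"
    by (metis stake_sdrop)
  then show "sprefix u s" by (auto simp: sprefix_def)
qed (auto simp: sprefix_def stake_shift)

lemma sprefix_prefix:
  assumes "sprefix u s" "sprefix v s" "length u \<le> length v"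
  shows "prefix u v"
  using assms unfolding sprefix_iff_stake
  by (metis take_is_prefix take_stake min.absorb1)

lemma length_concat_ge:
  assumes "\<And>i. i \<ge> m \<Longrightarrow> f i \<noteq> []"
  shows "n - m \<le> length (concat (map f [m..<n]))"
proof (cases "m \<le> n")
  case True
  then show ?thesis
  proof (induction n rule: dec_induct)
    case (step n)
    then show ?case
      using assms[of n] by (cases "f n") auto
  qed simp
qed simp

lemma eq_flatI:
  assumes "\<And>i. i \<ge> m \<Longrightarrow> f i \<noteq> []"
    and "\<And>n. n \<ge> m \<Longrightarrow> sprefix (concat (map f [m..<n])) s"
  shows "s = flat (smap f (fromN m))"
proof -
  have "s !! n = flat (smap f (fromN m)) !! n" for n
  proof -
    let ?v = "concat (map f [m..<m + Suc n])"
    have "n < length ?v"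
      using length_concat_ge[of m f "m + Suc n", OF assms(1)] by simp
    moreover have "sprefix ?v s"
      by (rule assms(2)) simp
    moreover have "sprefix ?v (flat (smap f (fromN m)))"
      using flat_smap_fromN[of m f "m + Suc n", OF assms(1)] by (metis le_add1 sprefix_shift)
    ultimately show ?thesis
      unfolding sprefix_def by (metis shift_snth_less)
  qed
  then have "(!!) s = (!!) (flat (smap f (fromN m)))"
    by blast
  then show ?thesis
    by (metis stream_smap_nats)
qed

text \<open>Two shortest candidates have equal length and are prefixes of the same remainder, so
  they agree. The remainder \<open>t\<close> is arbitrary in \<open>shortest\<close> because it is
  spelled by \<open>z\<close> and not by \<open>Z\<close> when uniqueness is proved.\<close>

lemma z_factorization_iff:
  assumes nonempty: "\<And>m. m \<ge> 1 \<Longrightarrow> Z m \<noteq> []"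
    and pre: "\<And>m. m \<ge> 1 \<Longrightarrow> sprefix (concat (map Z [1..<m])) s"
    and shortest: "\<And>m t. m \<ge> 1 \<Longrightarrow> s = concat (map Z [1..<m]) @- t \<Longrightarrow>
      is_arg_min length (\<lambda>p. p \<noteq> [] \<and> sprefix p t \<and>
        occurs_once p (concat (map Z [1..<m]) @ p)) (Z m)"
  shows "z_factorization s z \<longleftrightarrow> (\<forall>m\<ge>1. z m = Z m)"
proof
  assume z: "z_factorization s z"
  have "z m = Z m" if "m \<ge> 1" for m
    using that
  proof (induction m rule: less_induct)
    case (less m)
    define t where "t = flat (smap z (fromN m))"
    have eq: "concat (map z [1..<m]) = concat (map Z [1..<m])"
      using less.IH by (intro arg_cong[where f = concat] map_cong) auto
    have "s = concat (map Z [1..<m]) @- t"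
      using z less.prems flat_smap_fromN[of 1 z m]
      unfolding z_factorization_def t_def eq by metis
    from shortest[OF less.prems this]
    have Z: "is_arg_min length (\<lambda>p. p \<noteq> [] \<and> sprefix p t \<and>
        occurs_once p (concat (map Z [1..<m]) @ p)) (Z m)" .
    have "is_arg_min length (\<lambda>p. p \<noteq> [] \<and> sprefix p t \<and>
        occurs_once p (concat (map Z [1..<m]) @ p)) (z m)"
      using z less.prems unfolding z_factorization_def t_def eq[symmetric] by blast
    with Z have "length (z m) = length (Z m)" "sprefix (z m) t" "sprefix (Z m) t"
      unfolding is_arg_min_def by (metis linorder_neqE_nat, blast, blast)
    then show ?case
      by (metis sprefix_iff_stake)
  qed
  then show "\<forall>m\<ge>1. z m = Z m" by blast
next
  assume z: "\<forall>m\<ge>1. z m = Z m"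
  have eq: "concat (map z [1..<m]) = concat (map Z [1..<m])" for m
    using z by (intro arg_cong[where f = concat] map_cong) auto
  have flat: "s = flat (smap z (fromN 1))"
    by (rule eq_flatI) (use nonempty pre z eq in auto)
  moreover have "is_arg_min length (\<lambda>p. p \<noteq> [] \<and> sprefix p (flat (smap z (fromN m))) \<and>
             occurs_once p (concat (map z [1..<m]) @ p)) (z m)" if "m \<ge> 1" for m
  proof -
    have "s = concat (map Z [1..<m]) @- flat (smap z (fromN m))"
      unfolding eq[symmetric] using flat flat_smap_fromN[of 1 z m] nonempty z that by metis
    from shortest[OF that this] show ?thesis
      using z that unfolding eq by simp
  qed
  ultimately show "z_factorization s z"
    using nonempty z unfolding z_factorization_def by auto
qed

section \<open>One step of the factorization\<close>

lemma occurs_once_snoc: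
  assumes "\<not> sublist (p @ [c]) w"
  shows "occurs_once (p @ [c]) (w @ [c]) \<longleftrightarrow> suffix p w"
proof
  assume "occurs_once (p @ [c]) (w @ [c])"
  then obtain v v' where v: "w @ [c] = v @ (p @ [c]) @ v'"
    unfolding occurs_once_def by blast
  show "suffix p w"
  proof (cases v' rule: rev_cases)
    case Nil
    then show ?thesis using v by (auto simp: suffix_def)
  next
    case (snoc u b)
    then have "w = v @ (p @ [c]) @ u" using v by simp
    then show ?thesis using assms by (auto simp: sublist_def)
  qed
next
  assume "suffix p w"
  then obtain u where u: "w = u @ p" by (auto simp: suffix_def)
  show "occurs_once (p @ [c]) (w @ [c])"
    unfolding occurs_once_def
  proof (rule ex1I)
    show "\<exists>v'. w @ [c] = u @ (p @ [c]) @ v'" using u by simp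
  next
    fix v assume "\<exists>v'. w @ [c] = v @ (p @ [c]) @ v'"
    then obtain v' where v: "w @ [c] = v @ (p @ [c]) @ v'" by blast
    show "v = u"
    proof (cases v' rule: rev_cases)
      case Nil
      then show ?thesis using v u by simp
    next
      case (snoc v'' b)
      then have "w = v @ (p @ [c]) @ v''" using v by simp
      then show ?thesis using assms by (auto simp: sublist_def)
    qed
  qed
qed

text \<open>The word \<open>h @ Q\<close> has the period \<open>length h\<close> because \<open>Q\<close> is a prefix of it, so \<open>p\<close> occurs
  once more, one period earlier.\<close>

lemma not_occurs_once_periodic:
  assumes Q: "prefix (v @ p) (h @ Q)" "prefix Q (h @ Q)"
    and h: "h \<noteq> []" "length h \<le> length v"
  shows "\<not> occurs_once p (v @ p)"
proof
  assume once: "occurs_once p (v @ p)"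
  have "prefix h (v @ p)"
    using Q(1) h(2) by (metis prefixI prefix_length_prefix le_trans length_append le_add1)
  then obtain v1 where v1: "v = h @ v1"
    using h(2) by (metis prefix_def prefix_length_prefix prefixI)
  then have "prefix (v1 @ p) Q"
    using Q(1) by simp
  then have "prefix (v1 @ p) (h @ Q)"
    using Q(2) by (rule prefix_order.trans)
  then have "prefix (v1 @ p) (v @ p)"
    using Q(1) v1 by (metis prefix_length_prefix append_assoc length_append le_add2)
  then obtain q where "v @ p = v1 @ p @ q"
    by (auto simp: prefix_def)
  moreover have "v @ p = v @ p @ []" by simp
  ultimately have "v = v1"
    using once unfolding occurs_once_def by blast
  then show False
    using v1 h(1) by simp
qed

lemma foldr_psi_neq_Nil [simp]: "u \<noteq> [] \<Longrightarrow> foldr psi w u \<noteq> []"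
  by (induction w) auto

text \<open>The reversed word starts with \<open>y\<close>, so \<open>tl\<close> computes the
  quotient by \<open>[y]\<close>.\<close>

lemma word_power_rev_foldr_psi:
  assumes "n \<ge> 1"
  shows "word_power (rev (foldr psi w [y])) n = y # tl (word_power (rev (foldr psi w [y])) n)"
proof -
  obtain r where "foldr psi w [y] = r @ [y]"
    by (rule foldr_psi_snoc)
  then show ?thesis
    using assms by (cases n) (auto simp: word_power_Suc)
qed

text \<open>In the application \<open>pal w @ [y]\<close> is \<open>z\<^sub>1 ... z\<^sub>k\<close>,
  \<open>n\<close> is \<open>d\<^sub>k\<close>, \<open>c\<close> is
  \<open>y\<^sub>k\<^sub>+\<^sub>1\<close> and \<open>e @ [c]\<close> is
  \<open>z\<^sub>k\<^sub>+\<^sub>1\<close>.\<close>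

lemma is_arg_min_new_factor:
  fixes w :: "'a list" and y c :: 'a and n :: nat
  defines "e \<equiv> tl (word_power (rev (foldr psi w [y])) n)"
  assumes n: "n \<ge> 1" and c: "c \<noteq> y" and t: "sprefix (e @ [c]) t"
  shows "is_arg_min length (\<lambda>p. p \<noteq> [] \<and> sprefix p t \<and> occurs_once p ((pal w @ [y]) @ p))
    (e @ [c])"
proof -
  let ?h = "foldr psi w [y]"
  have P: "pal (w @ replicate n y) = (pal w @ [y]) @ e"
    using word_power_rev_foldr_psi[OF n, of w y] unfolding e_def pal_replicate' by simp
  obtain k where k: "n = Suc k"
    using n by (cases n) auto
  \<comment> \<open>Splitting off the last \<open>y\<close> leaves the word \<open>h\<close>
    unchanged, so the lemmas on one appended letter apply.\<close>
  have h: "foldr psi (w @ replicate k y) [y] = ?h"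
    by (simp only: foldr_append foldr_psi_replicate)
  have W: "w @ replicate n y = (w @ replicate k y) @ [y]"
    by (simp add: k replicate_append_same)
  have P': "pal (w @ replicate n y) = ?h @ pal (w @ replicate k y)"
    unfolding W pal_snoc' h ..
  obtain r where r: "?h = r @ [y]"
    by (rule foldr_psi_snoc)
  have "\<not> sublist (c # r) (pal (w @ replicate n y))"
    unfolding W by (rule not_sublist_pal[OF c]) (simp only: h r)
  then have "\<not> sublist (rev (c # r)) (rev (pal (w @ replicate n y)))"
    by (simp only: sublist_rev not_False_eq_True)
  then have "\<not> sublist (rev r @ [c]) (pal (w @ replicate n y))"
    using palindrome_pal[of "w @ replicate n y"] by (simp add: palindrome_def)
  \<comment> \<open>The last copy of \<open>rev h\<close> is \<open>y # rev r\<close>; even if it is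
    the only copy, \<open>tl\<close> removes just its \<open>y\<close>.\<close>
  moreover have "sublist (rev r @ [c]) (e @ [c])"
  proof -
    have "suffix (rev r) e"
      unfolding e_def k word_power_Suc' r
      by (cases "word_power (rev (r @ [y])) k") (auto simp: suffix_def)
    then show ?thesis by (auto simp: suffix_def intro!: suffix_imp_sublist)
  qed
  ultimately have "\<not> sublist (e @ [c]) (pal (w @ replicate n y))"
    using sublist_order.order_trans by blast
  moreover have "suffix e (pal (w @ replicate n y))"
    unfolding P by (simp add: suffix_def)
  ultimately have "occurs_once (e @ [c]) (pal (w @ replicate n y) @ [c])"
    by (simp add: occurs_once_snoc)
  then have once: "occurs_once (e @ [c]) ((pal w @ [y]) @ (e @ [c]))"
    unfolding P by simp
  \<comment> \<open>The bound on \<open>length h\<close> leaves room to move \<open>p\<close> one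
    period to the left.\<close>
  have "\<not> occurs_once p ((pal w @ [y]) @ p)" if "sprefix p t" "length p < length (e @ [c])" for p
  proof (rule not_occurs_once_periodic)
    have "prefix p e"
      using sprefix_prefix[OF that(1) sprefix_appendD[OF t]] that(2) by simp
    then show "prefix ((pal w @ [y]) @ p) (?h @ pal (w @ replicate k y))"
      unfolding P'[symmetric] P by (simp only: same_prefix_prefix)
    show "prefix (pal (w @ replicate k y)) (?h @ pal (w @ replicate k y))"
      unfolding P'[symmetric] unfolding pal_replicate' k word_power_Suc' by simp
    show "?h \<noteq> []" by simp
    show "length ?h \<le> length (pal w @ [y])"
      using length_foldr_psi_le[of w y] by simp
  qed
  with once t show ?thesis
    unfolding is_arg_min_def by auto
qed

section \<open>From the directive word to the theorem\<close>

lemma mu_eq_foldr_psi: "mu x n w = foldr psi (map x [1..<Suc n]) w"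
  by (induction n arbitrary: w) auto

lemma directive_word_sprefix:
  assumes "directive_word s x"
  shows "sprefix (pal (map x [1..<Suc n])) s"
proof -
  from assms obtain u where mono: "strict_mono_on {1..} (\<lambda>n. length (u n))"
    and im: "u ` {1..} = {p. palindrome p \<and> sprefix p s}"
    and step: "\<forall>n\<ge>1. u (n + 1) = pal_closure (u n @ [x n])"
    unfolding directive_word_def by blast
  \<comment> \<open>The empty palindromic prefix can only have index 1, as lengths increase
    strictly.\<close>
  have "[] \<in> u ` {1..}"
    unfolding im by (simp add: palindrome_def sprefix_def)
  then obtain k where k: "k \<ge> 1" "u k = []"
    by (metis atLeast_iff imageE)
  have "k = 1"
    using strict_mono_onD[OF mono, of 1 k] k by (cases "k = 1") auto
  then have u1: "u 1 = []" using k by simp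
  have "u (Suc n) = pal (map x [1..<Suc n])" for n
  proof (induction n)
    case (Suc n)
    then show ?case
      using step[rule_format, of "Suc n"] pal_snoc[of "map x [1..<Suc n]" "x (Suc n)"] by simp
  qed (use u1 in simp)
  moreover have "sprefix (u (Suc n)) s"
    using im by (metis atLeast_iff imageI mem_Collect_eq One_nat_def Suc_le_mono le0)
  ultimately show ?thesis by metis
qed

theorem theorem1:
  fixes A :: "'a set" and s :: "'a stream"
    and x y :: "nat \<Rightarrow> 'a" and d g :: "nat \<Rightarrow> nat"
  assumes "finite A" and "s \<in> streams A"
    and "standard_episturmian s"
    and "directive_word s x"
    and "smap x (fromN 1) = flat (smap (\<lambda>i. replicate (d i) (y i)) (fromN 1))"
    and "\<And>i. i \<ge> 1 \<Longrightarrow> x i \<in> A"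
    and "\<And>i. i \<ge> 1 \<Longrightarrow> y i \<in> A"
    and "\<And>i. i \<ge> 1 \<Longrightarrow> d i \<ge> 1"
    and "\<And>i. i \<ge> 1 \<Longrightarrow> y i \<noteq> y (i + 1)"
    and "\<And>m. m \<ge> 1 \<Longrightarrow> g m = (\<Sum>i = 1..<m. d i) + 1"
  shows "(\<forall>k\<ge>2. prefix [y (k - 1)] (word_power (rev (hword x (g (k - 1) - 1))) (d (k - 1)))) \<and>
    (\<forall>z. z_factorization s z \<longleftrightarrow>
       z 1 = [x 1] \<and>
       (\<forall>k\<ge>2. z k =
          left_quotient [y (k - 1)] (word_power (rev (hword x (g (k - 1) - 1))) (d (k - 1)))
            @ [y k]))"
proof -
  \<comment> \<open>\<open>W k\<close> spells the blocks before the \<open>k\<close>-th one, and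
    \<open>e k\<close> will be \<open>y\<^sub>k\<^sup>-\<^sup>1 (rev h)\<^sup>d\<close> with
    \<open>d = d\<^sub>k\<close>.\<close>
  define W where "W k = map x [1..<g k]" for k
  define f where "f i = replicate (d i) (y i)" for i
  define e where "e k = tl (word_power (rev (foldr psi (W k) [y k])) (d k))" for k
  define Z where "Z k = (if k = 1 then [x 1] else e (k - 1) @ [y k])" for k
  note x = assms(5) and d = assms(8) and y = assms(9) and g = assms(10)
  have f: "f i \<noteq> []" if "i \<ge> 1" for i
    using d[OF that] by (auto simp: f_def)
  have g1: "g (Suc 0) = Suc 0"
    using g[of 1] by simp
  have gSuc: "g (Suc k) = g k + d k" if "k \<ge> 1" for k
    using g[of k] g[of "Suc k"] that by simp
  have g_pos: "g k \<ge> 1" if "k \<ge> 1" for k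
    using g[OF that] by simp
  have split: "map x [1..<g k] = concat (map f [1..<k]) \<and> x (g k) = y k" if k: "k \<ge> 1" for k
  proof -
    have len: "length (concat (map f [1..<k])) = g k - 1"
      using k
    proof (induction k rule: dec_induct)
      case (step k)
      then show ?case
        using g_pos[of k] gSuc[of k] by (simp add: f_def)
    qed (use g1 in simp)
    have eq: "smap x (fromN 1) = concat (map f [1..<k]) @- flat (smap f (fromN k))"
      using flat_smap_fromN[of 1 f k] f k x unfolding f_def by metis
    \<comment> \<open>The first \<open>k - 1\<close> blocks have \<open>g k - 1\<close> letters;
      \<open>x\<close> counts from 1, stream positions from 0.\<close>
    have "map x [1..<g k] = stake (g k - 1) (smap x (fromN 1))"
      using g_pos[OF k] by (intro nth_equalityI) (auto simp: add.commute)
    also have "\<dots> = concat (map f [1..<k])"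
      unfolding eq using len by (simp add: stake_shift)
    finally have 1: "map x [1..<g k] = concat (map f [1..<k])" .
    have "x (g k) = smap x (fromN 1) !! (g k - 1)"
      using g_pos[OF k] by simp
    also have "\<dots> = shd (flat (smap f (fromN k)))"
      unfolding eq using len by (simp add: shift_snth_ge)
    also have "\<dots> = y k"
      using f[OF k] d[OF k] flat_unfold[of "smap f (fromN k)"] by (cases "d k") (auto simp: f_def)
    finally show ?thesis using 1 by simp
  qed
  have W1: "W 1 = []"
    by (simp add: W_def g1)
  have WSuc: "W (Suc k) = W k @ replicate (d k) (y k)" if "k \<ge> 1" for k
    using split[OF that] split[of "Suc k"] that unfolding W_def by (simp add: f_def)
  have power: "word_power (rev (foldr psi (W k) [y k])) (d k) = y k # e k" if "k \<ge> 1" for k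
    unfolding e_def by (rule word_power_rev_foldr_psi[OF d[OF that]])
  have hword: "hword x (g k - 1) = foldr psi (W k) [y k]" if "k \<ge> 1" for k
    using split[OF that] g_pos[OF that] by (simp add: hword_def mu_eq_foldr_psi W_def)
  have concat_Z: "concat (map Z [1..<Suc k]) = pal (W k) @ [y k]" if "k \<ge> 1" for k
    using that
  proof (induction k rule: dec_induct)
    case base
    then show ?case
      using split[of 1] g1 W1 by (simp add: Z_def)
  next
    case (step k)
    have "pal (W (Suc k)) = pal (W k) @ y k # e k"
      unfolding WSuc[OF step.hyps(1)] pal_replicate' power[OF step.hyps(1)] ..
    then show ?case
      using step by (simp add: Z_def)
  qed
  have pre: "sprefix (concat (map Z [1..<k])) s" if k: "k \<ge> 1" for k
  proof (cases "k = 1")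
    case False
    then obtain j where j: "k = Suc j" "j \<ge> 1"
      using k by (cases k) auto
    \<comment> \<open>This is again a prefix of the directive word, so its iterated closure, which
      begins with \<open>pal (W j) @ [y j]\<close>, is a prefix of \<open>s\<close>.\<close>
    have "W j @ [y j] = map x [1..<Suc (g j)]"
      using split[OF j(2)] g_pos[OF j(2)] by (simp add: W_def)
    then have "sprefix (pal (W j @ [y j])) s"
      using directive_word_sprefix[OF assms(4)] by metis
    moreover have "prefix (pal (W j) @ [y j]) (pal (W j @ [y j]))"
      unfolding pal_snoc by (rule prefix_pal_closure)
    ultimately show ?thesis
      unfolding j(1) concat_Z[OF j(2)] by (auto simp: prefix_def intro: sprefix_appendD)
  qed (simp add: sprefix_def)
  have iff: "z_factorization s z \<longleftrightarrow> (\<forall>m\<ge>1. z m = Z m)" for z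
  proof (rule z_factorization_iff)
    show "Z m \<noteq> []" for m by (simp add: Z_def)
    show "sprefix (concat (map Z [1..<m])) s" if "m \<ge> 1" for m
      using pre[OF that] .
  next
    fix m t
    assume m: "m \<ge> 1" and s: "s = concat (map Z [1..<m]) @- t"
    have t: "sprefix (Z m) t"
      using pre[of "Suc m"] m unfolding s by (auto simp: sprefix_def)
    show "is_arg_min length (\<lambda>p. p \<noteq> [] \<and> sprefix p t \<and>
        occurs_once p (concat (map Z [1..<m]) @ p)) (Z m)"
    proof (cases "m = 1")
      case True
      then show ?thesis
        using t by (auto simp: is_arg_min_def Z_def occurs_once_def Suc_le_eq Cons_eq_append_conv)
    next
      case False
      then obtain k where k: "m = Suc k" "k \<ge> 1"
        using m by (cases m) auto
      then have Zm: "Z m = e k @ [y (Suc k)]"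
        by (simp add: Z_def)
      show ?thesis
        using is_arg_min_new_factor[OF d[OF k(2)], of "y (Suc k)" "y k" "W k" t] y[OF k(2)] t
        unfolding k(1) concat_Z[OF k(2)] Zm[unfolded k(1)] e_def by auto
    qed
  qed
  have quotient: "left_quotient [a] (a # v) = v" for a :: 'a and v
    unfolding left_quotient_def by (rule the_equality) auto
  have formula: "left_quotient [y (k - 1)] (word_power (rev (hword x (g (k - 1) - 1))) (d (k - 1)))
      @ [y k] = Z k" if "k \<ge> 2" for k
    using that hword[of "k - 1"] power[of "k - 1"] quotient by (simp add: Z_def)
  have "prefix [y (k - 1)] (word_power (rev (hword x (g (k - 1) - 1))) (d (k - 1)))"
    if "k \<ge> 2" for k
    using that hword[of "k - 1"] power[of "k - 1"] by simp
  moreover have "z_factorization s z \<longleftrightarrow> z 1 = [x 1] \<and> (\<forall>k\<ge>2. z k =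
      left_quotient [y (k - 1)] (word_power (rev (hword x (g (k - 1) - 1))) (d (k - 1)))
        @ [y k])" for z
  proof -
    have "(\<forall>m\<ge>1. z m = Z m) \<longleftrightarrow> z 1 = Z 1 \<and> (\<forall>m\<ge>2. z m = Z m)"
      by (metis One_nat_def Suc_1 le_SucE le_add1 le_trans plus_1_eq_Suc not_less_eq_eq order_refl)
    then show ?thesis
      unfolding iff using formula by (auto simp: Z_def)
  qed
  ultimately show ?thesis by blast
qed

end
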